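(* Let $q$ be a prime power and let $d,n,s$ be positive integers with $\gcd(s,n)=1$, $d\geq 3$ and $n=d(d-1)+g$ for some $g\in\{1,\ldots,d-1\}$. Let $\sigma$ be the automorphism $x\mapsto x^{q^s}$ of $\mathbb{F}_{q^n}$. For $a,b\in\mathbb{F}_{q^n}$ and $t\in\{0,\ldots,d-1\}$ put \[ c_t(a,b)=\sum_{\substack{i_0,\ldots,i_t\geq 0\\ i_0+\cdots+i_t=d-1-t}}\ \left(\prod_{r=0}^{t}\ \prod_{j=1}^{i_r} a^{\sigma^{\,d(d-1-r-j-(i_0+\cdots+i_{r-1}))+g+r}}\right)\left(\prod_{u=0}^{t-1} b^{\sigma^{\,d(d-2-i_0-\cdots-i_u-u)+u+g}}\right), \] where for $r=0$ the sum $i_0+\cdots+i_{r-1}$ is $0$ and empty products are $1$. Then the $\mathbb{F}_q$-linear map $x\mapsto ax+bx^{\sigma}-x^{\sigma^d}$ on $\mathbb{F}_{q^n}$ has kernel of $\mathbb{F}_q$-dimension $d$ if and only if $a\neq 0$ and, for every $t\in\{0,\ldots,d-1\}$, \[ c_t(a,b)=\begin{cases}(-1)^v\, b^{\frac{\sigma^{v}-1}{\sigma-1}}\, a^{-\frac{\sigma^{v+1}-1}{\sigma-1}} & \text{if } t=d-g+v \text{ with } 0\leq v\leq g-1,\\ (-1)^g\, a^{-\frac{\sigma^{g}-1}{\sigma-1}}\, b^{\frac{\sigma^{g}-1}{\sigma-1}} & \text{if } t=0,\\ 0 & \text{otherwise.}\end{cases} \]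
   Context: Exponent notation: $a^{\sigma^i}$ means $\sigma^i(a)$; for integer $m\ge 0$, $a^{\frac{\sigma^{m}-1}{\sigma-1}}$ means $\prod_{i=0}^{m-1}\sigma^i(a)$ (equal to $1$ for $m=0$), and $a^{-\frac{\sigma^{m}-1}{\sigma-1}}$ is its inverse. *)

theory Defs
  imports Complex_Main "HOL-Number_Theory.Number_Theory"
begin

definition field_embedding :: "('k::field \<Rightarrow> 'a::field) \<Rightarrow> bool" where
  "field_embedding h \<longleftrightarrow>
     h 1 = 1 \<and> (\<forall>x y. h (x + y) = h x + h y) \<and> (\<forall>x y. h (x * y) = h x * h y)"

definition frob :: "nat \<Rightarrow> nat \<Rightarrow> 'a::field \<Rightarrow> 'a" where
  "frob q s x = x ^ (q ^ s)"

text \<open>\<open>sigma_power \<sigma> m a\<close> is \<open>a\<close> raised to the formal exponent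
  \<open>(\<sigma>^m - 1) / (\<sigma> - 1)\<close>.\<close>

definition sigma_power :: "('a::field \<Rightarrow> 'a) \<Rightarrow> nat \<Rightarrow> 'a \<Rightarrow> 'a" where
  "sigma_power \<sigma> m a = (\<Prod>i<m. (\<sigma> ^^ i) a)"

definition weak_compositions :: "nat \<Rightarrow> nat \<Rightarrow> nat list set" where
  "weak_compositions k N = {I. length I = k \<and> sum_list I = N}"

lemma finite_weak_compositions: "finite (weak_compositions k N)"
proof (rule finite_subset)
  show "weak_compositions k N \<subseteq> {I. set I \<subseteq> {..N} \<and> length I = k}"
    by (auto simp: weak_compositions_def dest: member_le_sum_list)
qed (simp add: finite_lists_length_eq)

text \<open>A tuple \<open>(i\<^sub>0, \<dots>, i\<^sub>t)\<close> is the list \<open>I\<close> with \<open>I ! r = i\<^sub>r\<close>. The subtractions on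
  \<^typ>\<open>nat\<close> below never truncate when \<open>t < d\<close>: in the first product
  \<open>r + j + i\<^sub>0 + \<dots> + i\<^bsub>r-1\<^esub> \<le> t + (d - 1 - t) = d - 1\<close>, and in the second one
  \<open>i\<^sub>0 + \<dots> + i\<^sub>u + u \<le> (d - 1 - t) + (t - 1) = d - 2\<close>.\<close>

definition c_coeff :: "('a::field \<Rightarrow> 'a) \<Rightarrow> nat \<Rightarrow> nat \<Rightarrow> nat \<Rightarrow> 'a \<Rightarrow> 'a \<Rightarrow> 'a" where
  "c_coeff \<sigma> d g t a b =
     (\<Sum>I\<in>weak_compositions (t + 1) (d - 1 - t).
        (\<Prod>r\<in>{0..t}. \<Prod>j\<in>{1..I ! r}.
           (\<sigma> ^^ (d * (d - 1 - r - j - (\<Sum>k<r. I ! k)) + g + r)) a) *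
        (\<Prod>u<t. (\<sigma> ^^ (d * (d - 2 - (\<Sum>k\<le>u. I ! k) - u) + u + g)) b))"

end

theory Submission
  imports Defs "HOL-Computational_Algebra.Polynomial"
begin

text \<open>Put \<open>f = a + b \<sigma> - \<sigma>\<^sup>d\<close>. A nonzero \<open>\<sigma>\<close>-polynomial of degree \<open>m\<close> has at most \<open>q^m\<close> roots, so
  \<open>dim (ker f) = d\<close> iff \<open>f\<close> divides \<open>\<sigma>^n - 1\<close> on the right. If \<open>W f = \<sigma>^n - 1\<close> with \<open>W\<close> of degree
  \<open>n - d\<close>, the image of \<open>f\<close> lies in the kernel of \<open>W\<close>, hence has at most \<open>q^(n - d)\<close> elements and the
  kernel of \<open>f\<close> at least \<open>q^d\<close>.

  Divisibility is tested in the basis \<open>\<sigma>^g, \<dots>, \<sigma>^(g + d - 1)\<close> modulo \<open>f\<close>, which is available when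
  \<open>a \<noteq> 0\<close>. Replacing \<open>\<sigma>^(e + d)\<close> by \<open>\<sigma>^e(a) \<sigma>^e + \<sigma>^e(b) \<sigma>^(e + 1)\<close> exactly \<open>d - 1\<close> times turns
  \<open>\<sigma>^n\<close> into \<open>\<Sum>t. c\<^sub>t \<sigma>^(g + t)\<close>: the summands of \<open>c\<^sub>t\<close> are the words with \<open>t\<close> letters \<open>b\<close> and
  \<open>d - 1 - t\<close> letters \<open>a\<close>, where \<open>i\<^sub>r\<close> counts the \<open>a\<close>'s between consecutive \<open>b\<close>'s. Reading the same
  relation as \<open>\<sigma>^e = \<sigma>^e(a)^(-1) (\<sigma>^(e + d) - \<sigma>^e(b) \<sigma>^(e + 1))\<close> and applying it for
  \<open>e = 0, \<dots>, g - 1\<close> expresses \<open>1\<close> in the same basis, and this is the right-hand side of the criterion.\<close>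

subsection \<open>Words of reductions\<close>

lemma weak_compositions_0: "weak_compositions 0 N = (if N = 0 then {[]} else {})"
  by (auto simp: weak_compositions_def)

lemma weak_compositions_Suc_0: "weak_compositions (Suc k) 0 = (#) 0 ` weak_compositions k 0"
  unfolding weak_compositions_def by (auto simp: length_Suc_conv)

text \<open>Split by the first entry: a positive one is lowered by one, a zero one is removed. For
  words, the first letter is \<open>a\<close> or \<open>b\<close>.\<close>

lemma weak_compositions_Suc_Suc:
  "weak_compositions (Suc k) (Suc N) =
    (\<lambda>I. Suc (hd I) # tl I) ` weak_compositions (Suc k) N \<union> (#) 0 ` weak_compositions k (Suc N)"
proof (intro equalityI subsetI)
  fix I assume "I \<in> weak_compositions (Suc k) (Suc N)"
  then obtain i J where I: "I = i # J" "length J = k" "i + sum_list J = Suc N"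
    by (auto simp: weak_compositions_def length_Suc_conv)
  show "I \<in> (\<lambda>I. Suc (hd I) # tl I) ` weak_compositions (Suc k) N \<union> (#) 0 ` weak_compositions k (Suc N)"
  proof (cases i)
    case (Suc i')
    then have "i' # J \<in> weak_compositions (Suc k) N" "I = Suc (hd (i' # J)) # tl (i' # J)"
      using I by (auto simp: weak_compositions_def)
    then show ?thesis by blast
  qed (use I in \<open>auto simp: weak_compositions_def\<close>)
qed (auto simp: weak_compositions_def length_Suc_conv)

lemma sum_weak_compositions_Suc_Suc:
  "(\<Sum>I\<in>weak_compositions (Suc k) (Suc N). f I) =
     (\<Sum>I\<in>weak_compositions (Suc k) N. f (Suc (hd I) # tl I)) +
     (\<Sum>I\<in>weak_compositions k (Suc N). f (0 # I))"
proof -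
  let ?S = "\<lambda>I. Suc (hd I) # tl I"
  have ne: "I \<noteq> []" if "I \<in> weak_compositions (Suc k) N" for I
    using that by (auto simp: weak_compositions_def)
  have inj: "inj_on ?S (weak_compositions (Suc k) N)"
    by (rule inj_onI) (metis list.collapse list.inject nat.inject ne)
  have disj: "?S ` weak_compositions (Suc k) N \<inter> (#) 0 ` weak_compositions k (Suc N) = {}"
    by blast
  show ?thesis
    unfolding weak_compositions_Suc_Suc
      sum.union_disjoint[OF finite_imageI finite_imageI disj, OF finite_weak_compositions finite_weak_compositions]
    using inj by (simp add: sum.reindex)
qed

text \<open>The summand of \<^const>\<open>c_coeff\<close>, with the number \<open>d - 1\<close> of letters replaced by \<open>m\<close>.\<close>

definition word_weight ::
  "('a::field \<Rightarrow> 'a) \<Rightarrow> 'a \<Rightarrow> 'a \<Rightarrow> nat \<Rightarrow> nat \<Rightarrow> nat \<Rightarrow> nat \<Rightarrow> nat list \<Rightarrow> 'a" where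
  "word_weight \<sigma> a b d m g t I =
     (\<Prod>r\<in>{0..t}. \<Prod>j\<in>{1..I ! r}. (\<sigma> ^^ (d * (m - r - j - (\<Sum>k<r. I ! k)) + g + r)) a) *
     (\<Prod>u<t. (\<sigma> ^^ (d * (m - 1 - (\<Sum>k\<le>u. I ! k) - u) + u + g)) b)"

lemma c_coeff_eq_sum_word_weight:
  "c_coeff \<sigma> d g t a b =
     (\<Sum>I\<in>weak_compositions (Suc t) (d - 1 - t). word_weight \<sigma> a b d (d - 1) g t I)"
  by (simp add: c_coeff_def word_weight_def diff_diff_eq numeral_2_eq_2)

text \<open>The leading letter \<open>a\<close> is the factor \<open>r = 0\<close>,
  \<open>j = 1\<close>. It raises every partial sum over a nonempty range by one, which offsets the
  passage from \<open>m\<close> to \<open>Suc m\<close>.\<close>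

lemma word_weight_Suc_Cons:
  "word_weight \<sigma> a b d (Suc m) g t (Suc i # J) =
     (\<sigma> ^^ (d * m + g)) a * word_weight \<sigma> a b d m g t (i # J)"
proof -
  have head: "(\<Prod>j\<in>{1..Suc i}. (\<sigma> ^^ (d * (Suc m - j) + g)) a) =
      (\<sigma> ^^ (d * m + g)) a * (\<Prod>j\<in>{1..i}. (\<sigma> ^^ (d * (m - j) + g)) a)"
    by (subst prod.atLeast_Suc_atMost, simp, subst prod.shift_bounds_cl_Suc_ivl, simp)
  have S: "(\<Sum>k<Suc r. (Suc i # J) ! k) = Suc (\<Sum>k<Suc r. (i # J) ! k)" for r
    by (subst (1 2) sum.lessThan_Suc_shift) simp
  have S': "(\<Sum>k\<le>u. (Suc i # J) ! k) = Suc (\<Sum>k\<le>u. (i # J) ! k)" for u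
    using S[of u] unfolding lessThan_Suc_atMost .
  have tail: "(\<Prod>r\<in>{1..t}. \<Prod>j\<in>{1..(Suc i # J) ! r}.
        (\<sigma> ^^ (d * (Suc m - r - j - (\<Sum>k<r. (Suc i # J) ! k)) + g + r)) a) =
      (\<Prod>r\<in>{1..t}. \<Prod>j\<in>{1..(i # J) ! r}.
        (\<sigma> ^^ (d * (m - r - j - (\<Sum>k<r. (i # J) ! k)) + g + r)) a)"
  proof (rule prod.cong[OF refl])
    fix r assume "r \<in> {1..t}"
    then obtain r' where r: "r = Suc r'" by (cases r) auto
    show "(\<Prod>j\<in>{1..(Suc i # J) ! r}.
        (\<sigma> ^^ (d * (Suc m - r - j - (\<Sum>k<r. (Suc i # J) ! k)) + g + r)) a) =
      (\<Prod>j\<in>{1..(i # J) ! r}. (\<sigma> ^^ (d * (m - r - j - (\<Sum>k<r. (i # J) ! k)) + g + r)) a)"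
      unfolding r S by (simp add: diff_diff_eq)
  qed
  have bs: "(\<Prod>u<t. (\<sigma> ^^ (d * (Suc m - 1 - (\<Sum>k\<le>u. (Suc i # J) ! k) - u) + u + g)) b) =
      (\<Prod>u<t. (\<sigma> ^^ (d * (m - 1 - (\<Sum>k\<le>u. (i # J) ! k) - u) + u + g)) b)"
    unfolding S' by (simp add: diff_diff_eq)
  show ?thesis
    unfolding word_weight_def bs
    by (subst (1 2) prod.atLeast_Suc_atMost) (use head tail in \<open>simp_all add: mult.assoc\<close>)
qed

text \<open>The leading letter \<open>b\<close> is the factor \<open>u = 0\<close>. Dropping the
  empty block \<open>r = 0\<close> shifts \<open>r\<close> and \<open>u\<close> by one, which lowers
  \<open>m\<close> and raises \<open>g\<close>.\<close>

lemma word_weight_0_Cons: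
  "word_weight \<sigma> a b d (Suc m) g (Suc t) (0 # J) =
     (\<sigma> ^^ (d * m + g)) b * word_weight \<sigma> a b d m (Suc g) t J"
proof -
  have S: "(\<Sum>k<Suc r. (0 # J) ! k) = (\<Sum>k<r. J ! k)" for r
    by (subst sum.lessThan_Suc_shift) simp
  have S': "(\<Sum>k\<le>Suc u. (0 # J) ! k) = (\<Sum>k\<le>u. J ! k)" for u
    using S[of "Suc u"] unfolding lessThan_Suc_atMost .
  show ?thesis
    unfolding word_weight_def
    by (subst prod.atLeast_Suc_atMost, simp, subst prod.shift_bounds_cl_Suc_ivl,
        subst prod.lessThan_Suc_shift) (simp add: S S' diff_diff_eq del: sum.lessThan_Suc sum.atMost_Suc)
qed

text \<open>Modulo \<open>a + b \<sigma> - \<sigma>\<^sup>d\<close>, \<open>m\<close> reductions turn \<open>\<sigma>^(d * m + g)\<close> into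
  \<open>\<Sum>t\<le>m. reduct_coeff \<sigma> a b d m g t * \<sigma>^(g + t)\<close>, with quotient coefficients
  \<open>- quot_coeff \<sigma> a b d m g k\<close>.\<close>

fun reduct_coeff :: "('a::field \<Rightarrow> 'a) \<Rightarrow> 'a \<Rightarrow> 'a \<Rightarrow> nat \<Rightarrow> nat \<Rightarrow> nat \<Rightarrow> nat \<Rightarrow> 'a" where
  "reduct_coeff \<sigma> a b d 0 g t = (if t = 0 then 1 else 0)"
| "reduct_coeff \<sigma> a b d (Suc m) g t =
     (\<sigma> ^^ (d * m + g)) a * reduct_coeff \<sigma> a b d m g t +
     (case t of 0 \<Rightarrow> 0 | Suc t' \<Rightarrow> (\<sigma> ^^ (d * m + g)) b * reduct_coeff \<sigma> a b d m (Suc g) t')"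

fun quot_coeff :: "('a::field \<Rightarrow> 'a) \<Rightarrow> 'a \<Rightarrow> 'a \<Rightarrow> nat \<Rightarrow> nat \<Rightarrow> nat \<Rightarrow> nat \<Rightarrow> 'a" where
  "quot_coeff \<sigma> a b d 0 g k = 0"
| "quot_coeff \<sigma> a b d (Suc m) g k =
     (\<sigma> ^^ (d * m + g)) a * quot_coeff \<sigma> a b d m g k +
     (\<sigma> ^^ (d * m + g)) b * quot_coeff \<sigma> a b d m (Suc g) k +
     (if k = d * m + g then 1 else 0)"

lemma reduct_coeff_eq_0: "m < t \<Longrightarrow> reduct_coeff \<sigma> a b d m g t = 0"
  by (induction m arbitrary: g t) (auto split: nat.split)

text \<open>The \<open>b\<close> branch raises \<open>g\<close> to \<open>Suc g\<close>. Since
  \<open>d \<ge> 2\<close>, the bound for \<open>Suc m\<close> still implies the one for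
  \<open>m\<close> at \<open>Suc g\<close>, and it keeps \<open>k\<close> above the new index
  \<open>d * m + g\<close>.\<close>

lemma quot_coeff_eq_0:
  assumes "d \<ge> 2" "k + 1 \<ge> d * m + g"
  shows "quot_coeff \<sigma> a b d m g k = 0"
  using assms(2)
proof (induction m arbitrary: g)
  case (Suc m)
  have "d * Suc m + g \<ge> d * m + Suc g + 1" using assms(1) by simp
  then show ?case using Suc by simp
qed simp

lemma quot_coeff_eq_0_above:
  "d \<ge> 2 \<Longrightarrow> d * m + g < k \<Longrightarrow> quot_coeff \<sigma> a b d (Suc m) g k = 0"
  by (simp add: quot_coeff_eq_0)

lemma quot_coeff_lead: "d \<ge> 2 \<Longrightarrow> quot_coeff \<sigma> a b d (Suc m) g (d * m + g) = 1"
  by (simp add: quot_coeff_eq_0)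

text \<open>Both sides obey the same recursion on the first letter. At \<open>t = 0\<close> only
  \<open>a\<close> can come first, at \<open>t = Suc m\<close> only \<open>b\<close>.\<close>

lemma reduct_coeff_eq_sum_word_weight:
  "t \<le> m \<Longrightarrow> reduct_coeff \<sigma> a b d m g t =
     (\<Sum>I\<in>weak_compositions (Suc t) (m - t). word_weight \<sigma> a b d m g t I)"
proof (induction m arbitrary: g t)
  case 0
  then show ?case
    by (simp add: weak_compositions_Suc_0 weak_compositions_0 word_weight_def)
next
  case (Suc m)
  have a_part: "(\<Sum>I\<in>weak_compositions (Suc t) (m - t).
        word_weight \<sigma> a b d (Suc m) g t (Suc (hd I) # tl I)) =
      (\<sigma> ^^ (d * m + g)) a * reduct_coeff \<sigma> a b d m g t" if "t \<le> m"
    unfolding word_weight_Suc_Cons Suc.IH[OF that] sum_distrib_left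
    by (rule sum.cong) (auto simp: weak_compositions_def length_Suc_conv)
  show ?case
  proof (cases t)
    case 0
    then show ?thesis using a_part
      by (simp add: sum_weak_compositions_Suc_Suc weak_compositions_0)
  next
    case (Suc t')
    have b_part: "(\<Sum>I\<in>weak_compositions (Suc t') (m - t'). word_weight \<sigma> a b d (Suc m) g t (0 # I)) =
        (\<sigma> ^^ (d * m + g)) b * reduct_coeff \<sigma> a b d m (Suc g) t'"
      using Suc.IH[of t' "Suc g"] Suc.prems Suc
      by (simp add: word_weight_0_Cons sum_distrib_left)
    show ?thesis
    proof (cases "t' < m")
      case True
      then have "m - t' = Suc (m - t)" using Suc by simp
      then show ?thesis using a_part b_part Suc True
        by (simp add: sum_weak_compositions_Suc_Suc)
    next
      case False
      then have "t' = m" using Suc Suc.prems by simp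
      then show ?thesis using b_part Suc
        by (simp add: reduct_coeff_eq_0 weak_compositions_Suc_0 sum.reindex)
    qed
  qed
qed

corollary c_coeff_eq_reduct_coeff:
  "t \<le> d - 1 \<Longrightarrow> c_coeff \<sigma> d g t a b = reduct_coeff \<sigma> a b d (d - 1) g t"
  by (simp only: c_coeff_eq_sum_word_weight reduct_coeff_eq_sum_word_weight)

subsection \<open>Reduction of skew polynomials\<close>

locale field_endo =
  fixes \<sigma> :: "'a::field \<Rightarrow> 'a"
  assumes hom_add: "\<sigma> (x + y) = \<sigma> x + \<sigma> y"
    and hom_mult: "\<sigma> (x * y) = \<sigma> x * \<sigma> y"
    and hom_one: "\<sigma> 1 = 1"
begin

lemma hom_zero: "\<sigma> 0 = 0"
  by (metis add_cancel_right_right hom_add)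

lemma hom_diff: "\<sigma> (x - y) = \<sigma> x - \<sigma> y"
  using hom_add[of "x - y" y] by (simp add: algebra_simps)

lemma hom_eq_0_iff: "\<sigma> x = 0 \<longleftrightarrow> x = 0"
proof
  assume "\<sigma> x = 0"
  then have "\<sigma> (x * inverse x) = 0" by (simp add: hom_mult)
  then show "x = 0" using hom_one by (cases "x = 0") auto
qed (simp add: hom_zero)

lemma hom_inverse: "\<sigma> (inverse x) = inverse (\<sigma> x)"
proof (cases "x = 0")
  case False
  then have "\<sigma> x * \<sigma> (inverse x) = 1" using hom_mult[of x "inverse x"] hom_one by simp
  then show ?thesis by (simp add: inverse_unique)
qed (simp add: hom_zero)

lemma inj_hom: "inj \<sigma>"
  by (rule injI) (metis hom_diff hom_eq_0_iff right_minus_eq)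

lemma field_endo_funpow: "field_endo (\<sigma> ^^ k)"
  by (induction k) (auto simp: field_endo_def hom_add hom_mult hom_one)

lemmas hom_funpow_simps =
  field_endo.hom_add[OF field_endo_funpow] field_endo.hom_diff[OF field_endo_funpow]
  field_endo.hom_mult[OF field_endo_funpow] field_endo.hom_inverse[OF field_endo_funpow]
  field_endo.hom_zero[OF field_endo_funpow] field_endo.hom_one[OF field_endo_funpow]
  field_endo.hom_eq_0_iff[OF field_endo_funpow]

lemma hom_funpow_funpow: "(\<sigma> ^^ i) ((\<sigma> ^^ j) x) = (\<sigma> ^^ (i + j)) x"
  by (simp add: funpow_add)

definition skew_eval :: "(nat \<Rightarrow> 'a) \<Rightarrow> nat \<Rightarrow> 'a \<Rightarrow> 'a" where
  "skew_eval w N x = (\<Sum>k<N. w k * (\<sigma> ^^ k) x)"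

text \<open>Apply \<open>\<sigma> ^^ (d * m + g)\<close> to the equation defining \<open>f\<close>
  and reduce the two resulting powers by induction, at \<open>g\<close> and at \<open>Suc g\<close>.
  The common length \<open>N\<close> lets the quotients be added.\<close>

lemma power_reduction:
  fixes a b :: 'a and d :: nat
  defines "f \<equiv> \<lambda>x. a * x + b * \<sigma> x - (\<sigma> ^^ d) x"
  assumes "d \<ge> 1" "d * m + g \<le> N"
  shows "(\<sigma> ^^ (d * m + g)) x =
    (\<Sum>t\<le>m. reduct_coeff \<sigma> a b d m g t * (\<sigma> ^^ (g + t)) x) -
    skew_eval (quot_coeff \<sigma> a b d m g) N (f x)"
  using assms(3)
proof (induction m arbitrary: g)
  case 0
  then show ?case by (simp add: skew_eval_def)
next
  case (Suc m)
  let ?e = "d * m + g" and ?R = "reduct_coeff \<sigma> a b d" and ?Q = "quot_coeff \<sigma> a b d"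
  have le: "?e < N" "d * m + Suc g \<le> N" using Suc.prems assms(2) by auto
  have "(\<sigma> ^^ (d * Suc m + g)) x = (\<sigma> ^^ ?e) ((\<sigma> ^^ d) x)"
    by (simp add: hom_funpow_funpow algebra_simps)
  also have "(\<sigma> ^^ d) x = a * x + b * \<sigma> x - f x"
    by (simp add: f_def)
  also have "(\<sigma> ^^ ?e) \<dots> = (\<sigma> ^^ ?e) a * (\<sigma> ^^ ?e) x
      + (\<sigma> ^^ ?e) b * (\<sigma> ^^ (d * m + Suc g)) x - (\<sigma> ^^ ?e) (f x)"
    using hom_funpow_funpow[of ?e 1 x] by (simp add: hom_funpow_simps)
  also have "\<dots> = (\<sigma> ^^ ?e) a * ((\<Sum>t\<le>m. ?R m g t * (\<sigma> ^^ (g + t)) x) - skew_eval (?Q m g) N (f x))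
      + (\<sigma> ^^ ?e) b * ((\<Sum>t\<le>m. ?R m (Suc g) t * (\<sigma> ^^ (Suc g + t)) x)
          - skew_eval (?Q m (Suc g)) N (f x)) - (\<sigma> ^^ ?e) (f x)"
    using le by (simp only: Suc.IH[of g] Suc.IH[of "Suc g"] less_imp_le)
  also have "(\<Sum>t\<le>m. ?R m g t * (\<sigma> ^^ (g + t)) x) = (\<Sum>t\<le>Suc m. ?R m g t * (\<sigma> ^^ (g + t)) x)"
    by (simp add: reduct_coeff_eq_0)
  also have "(\<sigma> ^^ ?e) b * ((\<Sum>t\<le>m. ?R m (Suc g) t * (\<sigma> ^^ (Suc g + t)) x)
          - skew_eval (?Q m (Suc g)) N (f x)) =
      (\<Sum>t\<le>Suc m. (case t of 0 \<Rightarrow> 0 | Suc t' \<Rightarrow> (\<sigma> ^^ ?e) b * ?R m (Suc g) t') * (\<sigma> ^^ (g + t)) x)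
          - (\<sigma> ^^ ?e) b * skew_eval (?Q m (Suc g)) N (f x)"
    by (subst sum.atMost_Suc_shift) (simp add: sum_distrib_left algebra_simps)
  also have "(\<sigma> ^^ ?e) (f x) = (\<Sum>k<N. (if k = ?e then 1 else 0) * (\<sigma> ^^ k) (f x))"
    using le by (simp add: if_distrib[of "\<lambda>c. c * _"] cong: if_cong)
  finally show ?case
    unfolding skew_eval_def reduct_coeff.simps quot_coeff.simps
    by (simp only: ring_distribs sum.distrib sum_distrib_left mult.assoc) (simp add: algebra_simps)
qed

lemma sigma_power_Suc: "sigma_power \<sigma> (Suc m) x = sigma_power \<sigma> m x * (\<sigma> ^^ m) x"
  by (simp add: sigma_power_def)

text \<open>Solve the equation defining \<open>f\<close> for \<open>x\<close>, apply
  \<open>\<sigma> ^^ g\<close>, and substitute into the remainder term: each round yields one term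
  at \<open>\<sigma> ^^ (d + g)\<close> and moves the remainder from \<open>\<sigma> ^^ g\<close> to
  \<open>\<sigma> ^^ Suc g\<close>.\<close>

lemma identity_expansion:
  fixes a b :: 'a and d :: nat
  defines "f \<equiv> \<lambda>x. a * x + b * \<sigma> x - (\<sigma> ^^ d) x"
    and "E \<equiv> \<lambda>v. (-1) ^ v * sigma_power \<sigma> v b * inverse (sigma_power \<sigma> (v + 1) a)"
  assumes "a \<noteq> 0"
  shows "x = (\<Sum>v<g. E v * (\<sigma> ^^ (d + v)) x)
    + (-1) ^ g * inverse (sigma_power \<sigma> g a) * sigma_power \<sigma> g b * (\<sigma> ^^ g) x
    + skew_eval E g (f x)"
proof (induction g)
  case 0
  then show ?case by (simp add: skew_eval_def sigma_power_def)
next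
  case (Suc g)
  have x: "x = inverse a * ((\<sigma> ^^ d) x - b * \<sigma> x + f x)"
    using assms(3) by (simp add: f_def field_simps)
  have "(\<sigma> ^^ g) x = (\<sigma> ^^ g) (inverse a * ((\<sigma> ^^ d) x - b * \<sigma> x + f x))"
    using arg_cong[OF x, of "\<sigma> ^^ g"] .
  also have "\<dots> = inverse ((\<sigma> ^^ g) a) *
      ((\<sigma> ^^ (d + g)) x - (\<sigma> ^^ g) b * (\<sigma> ^^ Suc g) x + (\<sigma> ^^ g) (f x))"
    by (simp add: hom_funpow_simps hom_funpow_funpow add.commute[of g] funpow_swap1)
  finally have *: "(\<sigma> ^^ g) x = inverse ((\<sigma> ^^ g) a) *
      ((\<sigma> ^^ (d + g)) x - (\<sigma> ^^ g) b * (\<sigma> ^^ Suc g) x + (\<sigma> ^^ g) (f x))" .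
  have "(-1) ^ g * inverse (sigma_power \<sigma> g a) * sigma_power \<sigma> g b * (\<sigma> ^^ g) x =
      E g * (\<sigma> ^^ (d + g)) x
      + (-1) ^ Suc g * inverse (sigma_power \<sigma> (Suc g) a) * sigma_power \<sigma> (Suc g) b * (\<sigma> ^^ Suc g) x
      + E g * (\<sigma> ^^ g) (f x)"
    unfolding * E_def sigma_power_Suc Suc_eq_plus1[symmetric] inverse_mult_distrib power_Suc
    by (simp only: ring_distribs mult_minus_left mult_minus_right mult_1_left mult_ac
        diff_conv_add_uminus add_ac)
  then show ?case
    by (subst Suc.IH) (simp only: skew_eval_def sum.lessThan_Suc add_ac)
qed

end

subsection \<open>Counting roots\<close>

text \<open>Every nonempty fibre of \<open>D\<close> is a translate of its kernel.\<close>

lemma card_additive_preimage_le: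
  fixes D :: "'a::{field,finite} \<Rightarrow> 'a"
  assumes diff: "\<And>x y. D (x - y) = D x - D y"
  shows "card {x. D x \<in> A} \<le> card A * card {x. D x = 0}"
proof -
  have fibre: "card {x. D x = y} \<le> card {x. D x = 0}" for y
  proof (cases "\<exists>x0. D x0 = y")
    case True
    then obtain x0 where "D x0 = y" ..
    then have "(\<lambda>x. x - x0) ` {x. D x = y} \<subseteq> {x. D x = 0}" by (auto simp: diff)
    then show ?thesis by (intro card_inj_on_le[of "\<lambda>x. x - x0"]) (auto simp: inj_on_def)
  qed simp
  have "{x. D x \<in> A} = (\<Union>y\<in>A. {x. D x = y})" by auto
  then have "card {x. D x \<in> A} \<le> (\<Sum>y\<in>A. card {x. D x = y})"
    by (simp add: card_UN_le)
  also have "\<dots> \<le> (\<Sum>y\<in>A. card {x. D x = 0})" by (rule sum_mono[OF fibre])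
  finally show ?thesis by simp
qed

text \<open>Summation by parts. With \<open>z k = (\<sigma> ^^ k) y\<close> it is right division by
  \<open>\<sigma> - 1\<close>, the total of the \<open>u\<close> being the remainder.\<close>

lemma abel_summation:
  fixes u z :: "nat \<Rightarrow> 'a::comm_ring"
  shows "(\<Sum>k<Suc M. u k * z k) =
    (\<Sum>i<Suc M. u i) * z M + (\<Sum>k<M. - (\<Sum>i<Suc k. u i) * (z (Suc k) - z k))"
  by (induction M) (simp_all add: algebra_simps)

locale finite_field_endo = field_endo \<sigma> for \<sigma> :: "'a::{field,finite} \<Rightarrow> 'a" +
  fixes q :: nat
  assumes card_fixed: "card {x. \<sigma> x = x} \<le> q"
begin

lemma q_pos: "0 < q"
proof -
  have "0 \<in> {x. \<sigma> x = x}" using hom_zero by simp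
  then have "0 < card {x. \<sigma> x = x}" by (metis card_gt_0_iff empty_iff finite)
  then show ?thesis using card_fixed by simp
qed

text \<open>If \<open>v\<close> is a nonzero root, then \<open>y \<mapsto> skew_eval w (v y)\<close> has the root \<open>1\<close>, so that \<open>\<sigma> - 1\<close>
  splits off on the right.\<close>

lemma card_skew_kernel_lead:
  "w m \<noteq> 0 \<Longrightarrow> card {x. skew_eval w (Suc m) x = 0} \<le> q ^ m"
proof (induction m arbitrary: w)
  case 0
  then have "{x. skew_eval w (Suc 0) x = 0} = {0}" by (auto simp: skew_eval_def)
  then show ?case by simp
next
  case (Suc m)
  let ?V = "{x. skew_eval w (Suc (Suc m)) x = 0}"
  show ?case
  proof (cases "?V \<subseteq> {0}")
    case True
    then have "card ?V \<le> 1" using card_mono[of "{0}" ?V] by simp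
    also have "1 \<le> q ^ Suc m" using q_pos by simp
    finally show ?thesis .
  next
    case False
    then obtain v where v: "skew_eval w (Suc (Suc m)) v = 0" "v \<noteq> 0" by auto
    \<comment> \<open>\<open>u\<close> holds the coefficients of the map sending \<open>y\<close> to
      \<open>skew_eval w (Suc (Suc m)) (v * y)\<close>, and \<open>Q\<close> those of its right
      quotient by \<open>\<sigma> - 1\<close>.\<close>
    define u where "u = (\<lambda>k. w k * (\<sigma> ^^ k) v)"
    define Q where "Q = (\<lambda>k. - (\<Sum>i<Suc k. u i))"
    have sum_u: "(\<Sum>i<Suc (Suc m). u i) = 0"
      using v(1) by (simp only: skew_eval_def u_def)
    then have "Q m = u (Suc m)"
      by (simp add: Q_def add_eq_0_iff)
    then have "Q m \<noteq> 0"
      using Suc.prems v(2) by (simp add: u_def hom_funpow_simps hom_eq_0_iff del: funpow.simps)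
    have factor: "skew_eval w (Suc (Suc m)) (v * y) = skew_eval Q (Suc m) (\<sigma> y - y)" for y
    proof -
      have "skew_eval w (Suc (Suc m)) (v * y) = (\<Sum>k<Suc (Suc m). u k * (\<sigma> ^^ k) y)"
        unfolding skew_eval_def u_def by (simp only: hom_funpow_simps mult.assoc)
      also have "\<dots> = (\<Sum>k<Suc m. Q k * ((\<sigma> ^^ Suc k) y - (\<sigma> ^^ k) y))"
        unfolding abel_summation sum_u Q_def by simp
      finally show ?thesis
        by (simp add: skew_eval_def hom_funpow_simps funpow_swap1)
    qed
    have "?V = (\<lambda>y. v * y) ` {y. skew_eval w (Suc (Suc m)) (v * y) = 0}"
    proof (intro equalityI subsetI)
      fix x assume "x \<in> ?V"
      moreover have "x = v * (x / v)" using v(2) by simp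
      ultimately show "x \<in> (\<lambda>y. v * y) ` {y. skew_eval w (Suc (Suc m)) (v * y) = 0}"
        by (metis (mono_tags, lifting) imageI mem_Collect_eq)
    qed auto
    then have "card ?V \<le> card {y. skew_eval w (Suc (Suc m)) (v * y) = 0}"
      by (simp only: card_image_le[OF finite])
    also have "\<dots> = card {y. skew_eval Q (Suc m) (\<sigma> y - y) = 0}"
      unfolding factor ..
    also have "\<dots> \<le> card {z. skew_eval Q (Suc m) z = 0} * card {y. \<sigma> y - y = 0}"
      using card_additive_preimage_le[of "\<lambda>y. \<sigma> y - y" "{z. skew_eval Q (Suc m) z = 0}"]
      by (simp add: hom_diff algebra_simps)
    also have "\<dots> \<le> q ^ m * q"
      by (rule mult_le_mono) (use Suc.IH[of Q, OF \<open>Q m \<noteq> 0\<close>] card_fixed in simp_all)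
    finally show ?thesis by (simp add: mult.commute)
  qed
qed

text \<open>Cutting \<open>w\<close> at its largest nonzero index makes the bound by the leading
  index applicable.\<close>

lemma card_skew_kernel:
  assumes "w k \<noteq> 0" "k < N"
  shows "card {x. skew_eval w N x = 0} \<le> q ^ (N - 1)"
proof -
  define m where "m = Max {k. k < N \<and> w k \<noteq> 0}"
  have "m \<in> {k. k < N \<and> w k \<noteq> 0}"
    unfolding m_def by (rule Max_in) (use assms in auto)
  then have m: "m < N" "w m \<noteq> 0" by auto
  have "w i = 0" if "m < i" "i < N" for i
    using Max_ge[of "{k. k < N \<and> w k \<noteq> 0}" i] that unfolding m_def by fastforce
  then have "skew_eval w N x = skew_eval w (Suc m) x" for x
    unfolding skew_eval_def using m(1) by (intro sum.mono_neutral_right) auto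
  then have "card {x. skew_eval w N x = 0} \<le> q ^ m"
    using card_skew_kernel_lead[of w m, OF m(2)] by simp
  also have "\<dots> \<le> q ^ (N - 1)"
    using m(1) q_pos by (intro power_increasing) auto
  finally show ?thesis .
qed

text \<open>Applied to a difference, this identifies the coefficients of two skew polynomials of
  degree below \<open>N\<close> that agree on \<open>q ^ N\<close> points.\<close>

lemma skew_eval_nonvanishing:
  assumes "q \<ge> 2" "card A = q ^ N" "N > 0" "\<And>x. x \<in> A \<Longrightarrow> skew_eval w N x = 0" "k < N"
  shows "w k = 0"
proof (rule ccontr)
  assume "w k \<noteq> 0"
  have "card A \<le> card {x. skew_eval w N x = 0}"
    using assms(4) by (intro card_mono) auto
  also have "\<dots> \<le> q ^ (N - 1)" using card_skew_kernel[of w k N, OF \<open>w k \<noteq> 0\<close> assms(5)] .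
  also have "\<dots> < q ^ N" using assms(1,3) by (intro power_strict_increasing) auto
  finally show False using assms(2) by simp
qed

theorem card_kernel_eq_iff:
  fixes a b :: 'a and d g n :: nat
  defines "f \<equiv> \<lambda>x. a * x + b * \<sigma> x - (\<sigma> ^^ d) x"
    and "E \<equiv> \<lambda>v. (-1) ^ v * sigma_power \<sigma> v b * inverse (sigma_power \<sigma> (v + 1) a)"
    and "E' \<equiv> (-1) ^ g * inverse (sigma_power \<sigma> g a) * sigma_power \<sigma> g b"
  assumes q: "q \<ge> 2" and card_UNIV: "card (UNIV :: 'a set) = q ^ n"
    and order: "\<And>x. (\<sigma> ^^ n) x = x"
    and d: "d \<ge> 2" and g: "1 \<le> g" "g < d" and n: "n = d * (d - 1) + g"
  shows "card {x. f x = 0} = q ^ d \<longleftrightarrow> a \<noteq> 0 \<and>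
    (\<forall>t<d. reduct_coeff \<sigma> a b d (d - 1) g t =
       (if t = 0 then E' else if d - g \<le> t then E (t - (d - g)) else 0))"
proof -
  define R where "R = reduct_coeff \<sigma> a b d (d - 1) g"
  define Q where "Q = quot_coeff \<sigma> a b d (d - 1) g"
  \<comment> \<open>Position \<open>t = d - g + v\<close> carries the power
    \<open>\<sigma> ^^ (d + v)\<close>, and \<open>t = 0\<close> the remainder; they do not collide
    because \<open>g < d\<close>.\<close>
  define e where "e = (\<lambda>t. if t = 0 then E' else if d - g \<le> t then E (t - (d - g)) else 0)"
  have f_diff: "f (x - y) = f x - f y" for x y
    by (simp add: f_def hom_diff hom_funpow_simps algebra_simps)
  have shift: "skew_eval w d ((\<sigma> ^^ g) x) = (\<Sum>t<d. w t * (\<sigma> ^^ (g + t)) x)" for w x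
    by (simp add: skew_eval_def hom_funpow_funpow add.commute)
  have reduction: "x = skew_eval R d ((\<sigma> ^^ g) x) - skew_eval Q n (f x)" for x
  proof -
    have "{..d - 1} = {..<d}" using d by auto
    then show ?thesis
      using power_reduction[of d "d - 1" g n x a b] d order[of x]
      unfolding shift R_def Q_def f_def n by simp
  qed
  have "(\<Sum>t<d. e t * (\<sigma> ^^ (g + t)) x) = (\<Sum>v<g. E v * (\<sigma> ^^ (d + v)) x) + E' * (\<sigma> ^^ g) x" for x
  proof -
    have "(\<Sum>t<d. e t * (\<sigma> ^^ (g + t)) x) = (\<Sum>t\<in>insert 0 {d - g..<d}. e t * (\<sigma> ^^ (g + t)) x)"
      using g by (intro sum.mono_neutral_right) (auto simp: e_def)
    also have "\<dots> = E' * (\<sigma> ^^ g) x + (\<Sum>t\<in>{d - g..<d}. e t * (\<sigma> ^^ (g + t)) x)"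
      using g by (simp add: e_def)
    also have "(\<Sum>t\<in>{d - g..<d}. e t * (\<sigma> ^^ (g + t)) x) = (\<Sum>v<g. E v * (\<sigma> ^^ (d + v)) x)"
      using g by (intro sum.reindex_bij_witness[of _ "\<lambda>v. v + (d - g)" "\<lambda>t. t - (d - g)"])
        (auto simp: e_def add.commute)
    finally show ?thesis by simp
  qed
  then have expansion: "x = skew_eval e d ((\<sigma> ^^ g) x) + skew_eval E g (f x)" if "a \<noteq> 0" for x
    using identity_expansion[OF that, where x = x and g = g and b = b and d = d] unfolding shift f_def E_def E'_def by simp
  have "card {x. f x = 0} = q ^ d \<longleftrightarrow> a \<noteq> 0 \<and> (\<forall>t<d. R t = e t)"
  proof (intro iffI conjI allI impI)
    assume card: "card {x. f x = 0} = q ^ d"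
    show "a \<noteq> 0"
    proof
      assume "a = 0"
      \<comment> \<open>For \<open>a = 0\<close>, \<open>f\<close> is
        \<open>b - \<sigma> ^^ (d - 1)\<close> applied after \<open>\<sigma>\<close>, too low in
        degree to vanish on \<open>q ^ d\<close> points.\<close>
      define w where "w = (\<lambda>k. (if k = 0 then b else 0) - (if k = d - 1 then 1 else 0))"
      have "skew_eval w d (\<sigma> x) = f x" for x
      proof -
        have "skew_eval w d y = b * y - (\<sigma> ^^ (d - 1)) y" for y
          unfolding skew_eval_def w_def left_diff_distrib sum_subtractf
          using d by (simp add: if_distrib[of "\<lambda>c. c * _"] cong: if_cong)
        moreover have "(\<sigma> ^^ (d - 1)) (\<sigma> x) = (\<sigma> ^^ d) x"
          using d hom_funpow_funpow[of "d - 1" 1 x] by simp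
        ultimately show ?thesis using \<open>a = 0\<close> by (simp add: f_def)
      qed
      then have vanish: "skew_eval w d y = 0" if "y \<in> \<sigma> ` {x. f x = 0}" for y
        using that by auto
      have card': "card (\<sigma> ` {x. f x = 0}) = q ^ d"
        using card card_image[OF inj_on_subset[OF inj_hom subset_UNIV]] by simp
      have "w (d - 1) = 0"
        using d by (intro skew_eval_nonvanishing[OF q card' _ vanish]) simp_all
      then show False using d by (simp add: w_def)
    qed
    fix t assume "t < d"
    \<comment> \<open>On the kernel of \<open>f\<close> both quotient terms vanish, so the two
      expressions for \<open>x\<close> agree there.\<close>
    have "skew_eval (\<lambda>t. R t - e t) d ((\<sigma> ^^ g) x) = 0" if "f x = 0" for x
      using reduction[of x] expansion[OF \<open>a \<noteq> 0\<close>, of x] that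
      by (simp add: skew_eval_def left_diff_distrib sum_subtractf hom_funpow_simps)
    then have vanish: "skew_eval (\<lambda>t. R t - e t) d y = 0" if "y \<in> (\<sigma> ^^ g) ` {x. f x = 0}" for y
      using that by auto
    have card': "card ((\<sigma> ^^ g) ` {x. f x = 0}) = q ^ d"
      using card card_image[OF inj_on_subset[OF field_endo.inj_hom[OF field_endo_funpow] subset_UNIV]]
      by simp
    have "R t - e t = 0"
      using skew_eval_nonvanishing[OF q card' _ vanish \<open>t < d\<close>] d by simp
    then show "R t = e t" by simp
  next
    assume *: "a \<noteq> 0 \<and> (\<forall>t<d. R t = e t)"
    \<comment> \<open>Subtracting the two expressions for \<open>x\<close> cancels \<open>R\<close>
      against \<open>e\<close>, so \<open>W\<close> annihilates the image of \<open>f\<close>. As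
      skew polynomials, \<open>W\<close> times \<open>f\<close> is
      \<open>1 - \<sigma> ^^ n\<close>.\<close>
    define W where "W = (\<lambda>k. Q k + (if k < g then E k else 0))"
    obtain d' where d': "d = Suc (Suc d')"
      using le_Suc_ex[OF d] by auto
    \<comment> \<open>This is \<open>n - d\<close>, the degree of \<open>W\<close>. As
      \<open>g \<le> D\<close>, the coefficients \<open>E\<close> stay below the leading
      one.\<close>
    define D where "D = d * d' + g"
    have D: "n = D + d" "g \<le> D"
      using n by (auto simp: D_def d')
    have W_lead: "W D = 1"
      using quot_coeff_lead[OF d, of \<sigma> a b d' g] D(2) by (simp add: W_def Q_def D_def d')
    have W_0: "W k = 0" if "D < k" for k
      using quot_coeff_eq_0_above[OF d, of d' g k \<sigma> a b] D(2) that
      by (simp add: W_def Q_def D_def d')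
    have W_eval: "skew_eval W (Suc D) (f x) = 0" for x
    proof -
      have "skew_eval W (Suc D) (f x) = skew_eval W n (f x)"
        unfolding skew_eval_def using D d W_0 by (intro sum.mono_neutral_left) auto
      also have "\<dots> = skew_eval Q n (f x) + (\<Sum>k<n. (if k < g then E k else 0) * (\<sigma> ^^ k) (f x))"
        by (simp add: skew_eval_def W_def distrib_right sum.distrib)
      also have "(\<Sum>k<n. (if k < g then E k else 0) * (\<sigma> ^^ k) (f x)) = skew_eval E g (f x)"
        unfolding skew_eval_def using D by (intro sum.mono_neutral_cong_right) auto
      also have "skew_eval Q n (f x) + skew_eval E g (f x) =
          skew_eval R d ((\<sigma> ^^ g) x) - skew_eval e d ((\<sigma> ^^ g) x)"
        using trans[OF reduction[symmetric] expansion, of x] * by (simp add: algebra_simps)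
      also have "\<dots> = 0"
        using * by (simp add: skew_eval_def)
      finally show ?thesis .
    qed
    have "card {x. f x = 0} \<le> q ^ d"
    proof -
      define w where "w = (\<lambda>k. (if k = 0 then a else 0) + (if k = 1 then b else 0) - (if k = d then 1 else 0))"
      have "f x = skew_eval w (Suc d) x" for x
        unfolding skew_eval_def w_def left_diff_distrib distrib_right sum_subtractf sum.distrib f_def
        using d by (simp add: if_distrib[of "\<lambda>c. c * _"] cong: if_cong del: sum.lessThan_Suc)
      moreover have "w d \<noteq> 0" using d by (simp add: w_def)
      ultimately show ?thesis using card_skew_kernel_lead[of w d] by simp
    qed
    moreover have "q ^ d \<le> card {x. f x = 0}"
    proof -
      \<comment> \<open>The preimage under \<open>f\<close> of the roots of \<open>W\<close> is the
        whole field.\<close>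
      have "q ^ (D + d) = card {x. f x \<in> {y. skew_eval W (Suc D) y = 0}}"
        using card_UNIV D(1) W_eval by simp
      also have "\<dots> \<le> card {y. skew_eval W (Suc D) y = 0} * card {x. f x = 0}"
        by (rule card_additive_preimage_le) (rule f_diff)
      also have "\<dots> \<le> q ^ D * card {x. f x = 0}"
        using card_skew_kernel_lead[of W D] W_lead by simp
      finally show ?thesis using q_pos by (simp add: power_add)
    qed
    ultimately show "card {x. f x = 0} = q ^ d" by simp
  qed
  then show ?thesis by (simp add: R_def e_def)
qed

end

subsection \<open>Finite fields and dimension\<close>

text \<open>By induction over a basis: each element of the enlarged span is uniquely
  \<open>x + scale c v\<close> with \<open>x\<close> in the old one, so its size is multiplied by
  that of the scalar field.\<close>

lemma card_eq_power_dim: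
  fixes scale :: "'k::{field,finite} \<Rightarrow> 'v::{ab_group_add,finite} \<Rightarrow> 'v"
  assumes "vector_space scale" "module.subspace scale V"
  shows "card V = card (UNIV :: 'k set) ^ vector_space.dim scale V"
proof -
  interpret vector_space scale by fact
  have "card (span B) = card (UNIV :: 'k set) ^ card B" if "independent B" for B
  proof -
    have "finite B" by simp
    then show ?thesis using that
    proof (induction B)
      case (insert v B)
      then have indep: "independent B" "v \<notin> span B"
        by (auto simp: independent_insert)
      have "span (insert v B) = (\<lambda>(c, x). x + scale c v) ` (UNIV \<times> span B)"
      proof (intro equalityI subsetI)
        fix x assume "x \<in> span (insert v B)"
        then obtain c where "x - scale c v \<in> span B" by (auto simp: span_breakdown_eq)
        then show "x \<in> (\<lambda>(c, x). x + scale c v) ` (UNIV \<times> span B)"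
          by (intro image_eqI[of _ _ "(c, x - scale c v)"]) auto
      next
        fix x assume "x \<in> (\<lambda>(c, x). x + scale c v) ` (UNIV \<times> span B)"
        then obtain c y where "y \<in> span B" "x = y + scale c v" by auto
        then have "x - scale c v \<in> span B" by simp
        then show "x \<in> span (insert v B)" unfolding span_breakdown_eq ..
      qed
      moreover have "inj_on (\<lambda>(c, x). x + scale c v) (UNIV \<times> span B)"
      proof (rule inj_onI, clarify)
        fix c c' x x' assume x: "x \<in> span B" "x' \<in> span B"
          and eq: "x + scale c v = x' + scale c' v"
        then have "scale (c - c') v = x' - x" by (simp add: algebra_simps)
        then have "scale (c - c') v \<in> span B" using x by (simp add: span_diff)
        then have "scale (inverse (c - c')) (scale (c - c') v) \<in> span B" by (rule span_scale)
        then have "c = c'" using indep(2) by (cases "c = c'") auto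
        then show "c = c' \<and> x = x'" using eq by simp
      qed
      ultimately show ?case using insert indep(1)
        by (simp add: card_image card_cartesian_product)
    qed (simp add: span_empty)
  qed
  moreover obtain B where "B \<subseteq> V" "independent B" "V \<subseteq> span B" "card B = dim V"
    using basis_exists[of V] by blast
  moreover have "span B = V"
    using \<open>B \<subseteq> V\<close> \<open>V \<subseteq> span B\<close> assms(2) by (metis span_minimal subset_antisym)
  ultimately show ?thesis by metis
qed

lemma power_card_eq_same:
  fixes x :: "'a::{field,finite}"
  shows "x ^ card (UNIV :: 'a set) = x"
proof (cases "x = 0")
  case False
  let ?U = "UNIV - {0 :: 'a}"
  have "bij_betw ((*) x) ?U ?U"
    using False by (intro bij_betwI[of _ _ _ "\<lambda>y. y / x"]) auto
  then have "(\<Prod>y\<in>?U. y) = (\<Prod>y\<in>?U. x * y)"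
    by (rule prod.reindex_bij_betw[symmetric])
  then have "x ^ card ?U = 1"
    by (simp add: prod.distrib)
  moreover have "card (UNIV :: 'a set) = Suc (card ?U)"
    using card_Suc_Diff1[of UNIV "0 :: 'a"] by simp
  ultimately show ?thesis by (simp only: power_Suc mult_1_right)
qed (simp add: finite_UNIV_card_ge_0)

lemma power_card_power_eq_same:
  fixes x :: "'a::{field,finite}"
  shows "x ^ (card (UNIV :: 'a set) ^ k) = x"
  by (induction k) (simp_all add: power_mult power_card_eq_same)

text \<open>The characteristic divides the order of the field, a power of \<open>p\<close>, and so
  equals \<open>p\<close>; hence \<open>q ^ s\<close> is a power of the characteristic.\<close>

lemma finite_field_power_add:
  fixes x y :: "'a::{field,finite}"
  assumes "primepow q" "card (UNIV :: 'a set) = q ^ n" "n > 0"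
  shows "(x + y) ^ (q ^ s) = x ^ (q ^ s) + y ^ (q ^ s)"
proof -
  obtain p k where pk: "prime p" "q = p ^ k"
    using assms(1) by (auto simp: primepow_def)
  have prime: "prime CHAR('a)"
    by (rule prime_CHAR_semidom) (rule finite_imp_CHAR_pos, rule finite)
  moreover have "CHAR('a) dvd p ^ (k * n)"
    using CHAR_dvd_CARD[where 'a = 'a] assms(2) pk(2) by (simp add: power_mult)
  ultimately have "CHAR('a) = p"
    using pk(1) by (metis prime_dvd_power primes_dvd_imp_eq)
  then show ?thesis
    using freshmans_dream'[OF prime, of "q ^ s" "k * s"] pk(2) by (simp add: power_mult)
qed

lemma frob_funpow: "(frob q s ^^ k) x = x ^ (q ^ (s * k))"
  by (induction k) (simp_all add: frob_def algebra_simps flip: power_mult power_add)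

text \<open>Coprimality turns a fixed point of \<open>frob q s\<close> into one of the
  \<open>q\<close>-th power map, hence into a root of \<open>X^q - X\<close>.\<close>

lemma card_frob_fixed_le:
  assumes "card (UNIV :: 'a::{field,finite} set) = q ^ n" "coprime s n" "q \<ge> 2" "s > 0"
  shows "card {x :: 'a. frob q s x = x} \<le> q"
proof -
  have fixed: "x ^ q = x" if x: "frob q s x = x" for x :: 'a
  proof -
    \<comment> \<open>Bezout: \<open>j\<close> iterations raise to the power
      \<open>q ^ (n * k + 1)\<close>, of which \<open>q ^ (n * k)\<close> acts trivially on a field
      with \<open>q ^ n\<close> elements.\<close>
    obtain j k where jk: "s * j = n * k + gcd s n"
      using bezout_nat[of s n] assms(4) by auto
    have "(frob q s ^^ i) x = x" for i
      by (induction i) (simp_all add: x)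
    then have "x = x ^ (q ^ (n * k + 1))"
      using frob_funpow[of j q s x] jk assms(2) by simp
    also have "\<dots> = (x ^ ((q ^ n) ^ k)) ^ q"
      by (simp add: mult.commute flip: power_mult)
    also have "x ^ ((q ^ n) ^ k) = x"
      using power_card_power_eq_same[of x k] assms(1) by simp
    finally show ?thesis by simp
  qed
  define P where "P = [:0, 1 :: 'a:] ^ q - [:0, 1:]"
  have deg: "Polynomial.degree ([:0, 1 :: 'a:] ^ q) = q" "Polynomial.degree [:0, 1 :: 'a:] = 1"
    by (simp_all add: Polynomial.degree_linear_power)
  then have "P \<noteq> 0" using assms(3) by (auto simp: P_def)
  have "{x. frob q s x = x} \<subseteq> {x. poly P x = 0}"
    using fixed by (auto simp: P_def)
  then have "card {x :: 'a. frob q s x = x} \<le> card {x. poly P x = 0}"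
    by (rule card_mono[OF finite])
  also have "\<dots> \<le> Polynomial.degree P" by (rule card_poly_roots_bound[OF \<open>P \<noteq> 0\<close>])
  also have "\<dots> \<le> q"
    unfolding P_def using assms(3) deg by (intro Polynomial.degree_diff_le) simp_all
  finally show ?thesis .
qed

theorem theorem1p4:
  fixes h :: "'k::{field,finite} \<Rightarrow> 'a::{field,finite}"
    and q d n s g :: nat
    and \<sigma> :: "'a \<Rightarrow> 'a"
    and a b :: 'a
  assumes "primepow q"
    and "card (UNIV :: 'k set) = q" and "card (UNIV :: 'a set) = q ^ n" and "field_embedding h"
    and "d > 0" and "n > 0" and "s > 0" and "coprime s n" and "d \<ge> 3"
    and "g \<in> {1..d - 1}" and "n = d * (d - 1) + g"
    and "\<sigma> = frob q s"
  shows "vector_space.dim (\<lambda>c x. h c * x) {x. a * x + b * \<sigma> x - (\<sigma> ^^ d) x = 0} = d \<longleftrightarrow>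
    a \<noteq> 0 \<and>
    (\<forall>t\<in>{0..d - 1}.
       (\<forall>v\<in>{0..g - 1}. t = d - g + v \<longrightarrow>
          c_coeff \<sigma> d g t a b =
            (-1) ^ v * sigma_power \<sigma> v b * inverse (sigma_power \<sigma> (v + 1) a)) \<and>
       (t = 0 \<longrightarrow>
          c_coeff \<sigma> d g t a b =
            (-1) ^ g * inverse (sigma_power \<sigma> g a) * sigma_power \<sigma> g b) \<and>
       (t \<noteq> 0 \<and> \<not> (\<exists>v\<in>{0..g - 1}. t = d - g + v) \<longrightarrow> c_coeff \<sigma> d g t a b = 0))"
proof -
  let ?V = "{x. a * x + b * \<sigma> x - (\<sigma> ^^ d) x = 0}"
  have q: "q \<ge> 2"
    using primepow_gt_Suc_0[OF assms(1)] by simp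
  have \<sigma>: "\<sigma> x = x ^ (q ^ s)" for x
    by (simp add: assms(12) frob_def)
  interpret finite_field_endo \<sigma> q
  proof
    show "\<sigma> (x + y) = \<sigma> x + \<sigma> y" for x y
      unfolding \<sigma> using finite_field_power_add[OF assms(1,3,6)] .
    show "card {x. \<sigma> x = x} \<le> q"
      unfolding assms(12) using card_frob_fixed_le[OF assms(3,8) q assms(7)] .
  qed (simp_all add: \<sigma> power_mult_distrib)
  have order: "(\<sigma> ^^ n) x = x" for x
    unfolding assms(12) frob_funpow
    using power_card_power_eq_same[of x s] by (simp add: assms(3) mult.commute flip: power_mult)
  have h: "h 1 = 1" "h (c + c') = h c + h c'" "h (c * c') = h c * h c'" for c c'
    using assms(4) by (auto simp: field_embedding_def)
  have vs: "vector_space (\<lambda>c x. h c * x)"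
    by unfold_locales (simp_all add: h algebra_simps)
  have h_power: "h (c ^ k) = h c ^ k" for c k
    by (induction k) (simp_all add: h)
  \<comment> \<open>The scalar field has \<open>q\<close> elements, so \<open>\<sigma>\<close> fixes
    its image under \<open>h\<close>; this makes \<open>f\<close> linear and its kernel a
    subspace.\<close>
  have \<sigma>_h: "\<sigma> (h c) = h c" for c
    unfolding \<sigma> h_power[symmetric]
    using power_card_power_eq_same[of c s] by (simp add: assms(2))
  have \<sigma>_pow_h: "(\<sigma> ^^ k) (h c) = h c" for c k
    by (induction k) (simp_all add: \<sigma>_h)
  define f where "f = (\<lambda>x. a * x + b * \<sigma> x - (\<sigma> ^^ d) x)"
  have "f (x + y) = f x + f y" "f (h c * x) = h c * f x" "f 0 = 0" for x y c
    by (simp_all add: f_def hom_add hom_mult hom_zero hom_funpow_simps \<sigma>_h \<sigma>_pow_h algebra_simps)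
  then have "module.subspace (\<lambda>c x. h c * x) {x. f x = 0}"
    unfolding module.subspace_def[OF module_iff_vector_space[THEN iffD2, OF vs]] by simp
  then have "module.subspace (\<lambda>c x. h c * x) ?V"
    by (simp only: f_def)
  then have "card ?V = q ^ vector_space.dim (\<lambda>c x. h c * x) ?V"
    using card_eq_power_dim[OF vs] assms(2) by simp
  then have "vector_space.dim (\<lambda>c x. h c * x) ?V = d \<longleftrightarrow> card ?V = q ^ d"
    using q by simp
  also have "\<dots> \<longleftrightarrow> a \<noteq> 0 \<and> (\<forall>t<d. reduct_coeff \<sigma> a b d (d - 1) g t =
      (if t = 0 then (-1) ^ g * inverse (sigma_power \<sigma> g a) * sigma_power \<sigma> g b
       else if d - g \<le> t then (-1) ^ (t - (d - g)) * sigma_power \<sigma> (t - (d - g)) b *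
          inverse (sigma_power \<sigma> (t - (d - g) + 1) a)
       else 0))"
    by (rule card_kernel_eq_iff[OF q assms(3) order _ _ _ assms(11)]) (use assms(9,10) in auto)
  also have "(\<forall>t<d. reduct_coeff \<sigma> a b d (d - 1) g t =
      (if t = 0 then (-1) ^ g * inverse (sigma_power \<sigma> g a) * sigma_power \<sigma> g b
       else if d - g \<le> t then (-1) ^ (t - (d - g)) * sigma_power \<sigma> (t - (d - g)) b *
          inverse (sigma_power \<sigma> (t - (d - g) + 1) a)
       else 0)) \<longleftrightarrow>
    (\<forall>t\<in>{0..d - 1}.
       (\<forall>v\<in>{0..g - 1}. t = d - g + v \<longrightarrow>
          c_coeff \<sigma> d g t a b =
            (-1) ^ v * sigma_power \<sigma> v b * inverse (sigma_power \<sigma> (v + 1) a)) \<and>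
       (t = 0 \<longrightarrow>
          c_coeff \<sigma> d g t a b =
            (-1) ^ g * inverse (sigma_power \<sigma> g a) * sigma_power \<sigma> g b) \<and>
       (t \<noteq> 0 \<and> \<not> (\<exists>v\<in>{0..g - 1}. t = d - g + v) \<longrightarrow> c_coeff \<sigma> d g t a b = 0))"
    (is "(\<forall>t<d. ?R t = ?e t) \<longleftrightarrow> (\<forall>t\<in>{0..d - 1}. ?P t)")
  proof -
    have "?R t = ?e t \<longleftrightarrow> ?P t" if "t < d" for t
    proof -
      have R: "?R t = c_coeff \<sigma> d g t a b"
        using that by (subst c_coeff_eq_reduct_coeff) auto
      consider "t = 0" | "t \<noteq> 0" "t < d - g" | v where "v \<in> {0..g - 1}" "t = d - g + v"
      proof (cases "t < d - g")
        case False
        then have "t - (d - g) \<in> {0..g - 1}" "t = d - g + (t - (d - g))"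
          using \<open>t < d\<close> assms(10) by auto
        then show ?thesis by (rule that(3))
      qed (use that(1,2) in blast)
      then show ?thesis
      proof cases
        case 1
        then show ?thesis using R assms(10) by auto
      next
        case 2
        then show ?thesis using R by auto
      next
        case 3
        then show ?thesis using R assms(10) by auto
      qed
    qed
    moreover have "{0..d - 1} = {..<d}" using assms(5) by auto
    ultimately show ?thesis by auto
  qed
  finally show ?thesis .
qed

end
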